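(* For every integer $d\geq 1$, the set of universal translation vectors $\mathcal U_d^{\mathrm{Rational}}=\mathcal U_d^{\mathrm{Real}}=\mathcal A_d$ may be expressed as $$\mathcal A_d=\bigcap_{\substack{(q_0,\ldots,q_d)\in\mathbb Z^{d+1}\\ (q_1,\ldots,q_d)\neq\mathbf 0}}\left\{\mathbf y\in\mathbb R^d : q_0+q_1y_1+\cdots+q_dy_d\neq 0\right\}.$$ Consequently, $\mathcal A_d$ is a dense $G_\delta$-subset of $\mathbb R^d$, and its complement $\mathbb R^d\setminus\mathcal A_d$ has Lebesgue measure zero.
   Context: $\mathcal A_d:=\{\mathbf y=(y_1,\ldots,y_d)\in\mathbb R^d : 1,y_1,\ldots,y_d \text{ are linearly independent over }\mathbb Q\}$. $\mathcal P_d(\mathbb Q)$ denotes the collection of all full-dimensional rational (convex) polytopes in $\mathbb R^d$, i.e. convex hulls of finitely many points of $\mathbb Q^d$ with nonempty interior in $\mathbb R^d$. For a bounded polytope $K\subset\mathbb R^d$ and real $t>0$, $L_K(t):=|tK\cap\mathbb Z^d|$. Define $$\mathcal U_d^{\mathrm{Real}}:=\{\mathbf y\in\mathbb R^d : \text{for all } P,Q\in\mathcal P_d(\mathbb Q),\ \big(L_{P+\mathbf y}(t)=L_{Q+\mathbf y}(t)\ \text{for all real } t>0\big)\Rightarrow P=Q\},$$ $$\mathcal U_d^{\mathrm{Rational}}:=\{\mathbf y\in\mathbb R^d : \text{for all } P,Q\in\mathcal P_d(\mathbb Q),\ \big(L_{P+\mathbf y}(t)=L_{Q+\mathbf y}(t)\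 \text{for all } t\in\mathbb Q_{>0}\big)\Rightarrow P=Q\}.$$ *)

theory Defs
  imports "HOL-Analysis.Analysis"
begin

global_interpretation rat_real: vector_space "\<lambda>(q::rat) (x::real). of_rat q * x"
  by unfold_locales (simp_all add: algebra_simps of_rat_add of_rat_mult)

text \<open>The type \<open>'n\<close> indexes the coordinates, so the dimension is \<open>d = CARD('n) \<ge> 1\<close>.
  Linear independence is that of the family \<open>1, y\<^sub>1, \<dots>, y\<^sub>d\<close>,
  here indexed by \<open>'n option\<close>: independence of its range alone would overlook repeated entries.\<close>

definition A_set :: "(real ^ 'n) set" where
  "A_set = {y. let f = (\<lambda>i. case i of None \<Rightarrow> 1 | Some j \<Rightarrow> y $ j)
               in inj f \<and> rat_real.independent (range f)}"

definition rational_polytopes :: "(real ^ 'n) set set" where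
  "rational_polytopes =
     {P. \<exists>V. finite V \<and> (\<forall>v\<in>V. \<forall>i. v $ i \<in> \<rat>) \<and> P = convex hull V \<and> interior P \<noteq> {}}"

definition lattice_count :: "(real ^ 'n) set \<Rightarrow> real \<Rightarrow> nat" where
  "lattice_count K t = card ((*\<^sub>R) t ` K \<inter> {z. \<forall>i. z $ i \<in> \<int>})"

definition U_real :: "(real ^ 'n) set" where
  "U_real = {y. \<forall>P\<in>rational_polytopes. \<forall>Q\<in>rational_polytopes.
     (\<forall>t>0. lattice_count ((\<lambda>x. x + y) ` P) t = lattice_count ((\<lambda>x. x + y) ` Q) t)
       \<longrightarrow> P = Q}"

definition U_rational :: "(real ^ 'n) set" where
  "U_rational = {y. \<forall>P\<in>rational_polytopes. \<forall>Q\<in>rational_polytopes.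
     (\<forall>t\<in>\<rat>. t > 0 \<longrightarrow>
        lattice_count ((\<lambda>x. x + y) ` P) t = lattice_count ((\<lambda>x. x + y) ` Q) t)
       \<longrightarrow> P = Q}"

end

theory Submission
  imports Defs
begin

text \<open>If \<open>y\<close> is not in \<open>A_set\<close>, an integer shear fixing the relation \<open>q\<^sub>0 + q \<bullet> y = 0\<close> (a reflection
  when \<open>d = 1\<close>) moves \<open>y\<close> by a rational vector, so it carries some \<open>P + y\<close> to \<open>Q + y\<close> with
  \<open>Q \<noteq> P\<close> rational and the same counts.

  Conversely, with \<open>s = 1 / t\<close> the count of \<open>P + y\<close> is the number of integer points \<open>z\<close> whose ray
  \<open>s z - y\<close> is in \<open>P\<close> at time \<open>s\<close>. If \<open>Q\<close> is not contained in \<open>P\<close>, some facet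
  inequality \<open>a \<bullet> x \<le> b\<close> of \<open>P\<close> fails on \<open>Q\<close>; let a ray with integer direction hit this facet at time
  \<open>s\<^sub>0\<close>. For \<open>y\<close> in \<open>A_set\<close> every boundary contact at time \<open>s\<^sub>0\<close>, of \<open>P\<close> or of \<open>Q\<close>, happens on the
  hyperplane \<open>a \<bullet> x = b\<close>, where \<open>P\<close> lies on one side and \<open>Q\<close> can only touch it from the other.
  So when \<open>s\<close> passes \<open>s\<^sub>0\<close> in the direction given by the sign of \<open>b + a \<bullet> y\<close>, the count of \<open>P\<close> drops
  strictly while that of \<open>Q\<close> does not drop. Both counts are locally constant on either side of
  \<open>s\<^sub>0\<close>, so rational times suffice.\<close>

section \<open>Rational relations, and the topology and measure of \<open>A_set\<close>\<close>

lemma clear_denominators: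
  fixes f :: "'i \<Rightarrow> real"
  assumes "finite I" "\<And>i. i \<in> I \<Longrightarrow> f i \<in> \<rat>"
  shows "\<exists>N>0. \<forall>i\<in>I. real N * f i \<in> \<int>"
  using assms
proof (induction I rule: finite_induct)
  case empty
  then show ?case by auto
next
  case (insert j I)
  then obtain N where N: "N > 0" "\<forall>i\<in>I. real N * f i \<in> \<int>" by auto
  obtain m n where mn: "n > 0" "f j = of_int m / of_int n"
    using insert.prems[of j] by (auto elim: Rats_cases')
  have "real (N * nat n) * f i \<in> \<int>" if "i \<in> insert j I" for i
  proof (cases "i = j")
    case True
    have "real (N * nat n) * f j = of_int (int N * m)" using mn by simp
    then show ?thesis using True by (metis Ints_of_int)
  next
    case False
    then have "real N * f i \<in> \<int>" using N that by auto
    then have "real (nat n) * (real N * f i) \<in> \<int>" by (rule Ints_mult[OF Ints_of_nat])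
    also have "real (nat n) * (real N * f i) = real (N * nat n) * f i" by simp
    finally show ?thesis .
  qed
  then show ?case using N(1) mn(1) by (intro exI[of _ "N * nat n"]) auto
qed

text \<open>The working form of membership. Injectivity of the family is absorbed into it, because a
  repeated entry is itself a nontrivial rational relation.\<close>

lemma mem_A_set_iff_rational:
  fixes y :: "real ^ 'n"
  shows "y \<in> A_set \<longleftrightarrow>
    (\<forall>a b. b \<in> \<rat> \<longrightarrow> (\<forall>i. a $ i \<in> \<rat>) \<longrightarrow> b + a \<bullet> y = 0 \<longrightarrow> b = 0 \<and> a = 0)"
    (is "_ \<longleftrightarrow> ?R")
proof -
  define f where "f = (\<lambda>i::'n option. case i of None \<Rightarrow> 1 | Some j \<Rightarrow> y $ j)"
  have A: "y \<in> A_set \<longleftrightarrow> inj f \<and> rat_real.independent (range f)"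
    by (simp add: A_set_def f_def Let_def)
  have sum_option: "(\<Sum>i\<in>UNIV. g i) = g None + (\<Sum>j\<in>UNIV. g (Some j))" for g :: "'n option \<Rightarrow> real"
    by (simp add: UNIV_option_conv sum.reindex)
  show ?thesis
  proof
    assume "y \<in> A_set"
    then have inj: "inj f" and ind: "rat_real.independent (range f)" using A by auto
    show ?R
    proof (intro allI impI)
      fix a :: "real ^ 'n" and b :: real
      assume b: "b \<in> \<rat>" and a: "\<forall>i. a $ i \<in> \<rat>" and eq: "b + a \<bullet> y = 0"
      obtain b' where b': "b = of_rat b'" using b by (auto elim: Rats_cases)
      have "\<exists>r. a $ i = of_rat r" for i using a[rule_format, of i] by (auto elim: Rats_cases)
      then obtain a' where a': "\<And>i. a $ i = of_rat (a' i)" by metis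
      define u where "u i = (case i of None \<Rightarrow> b' | Some j \<Rightarrow> a' j)" for i
      \<comment> \<open>Independence attaches coefficients to vectors rather than indices;
        \<open>inv f\<close> translates, since \<open>f\<close> is injective.\<close>
      have "(\<Sum>v\<in>range f. of_rat (u (inv f v)) * v) = (\<Sum>i\<in>UNIV. of_rat (u i) * f i)"
        using inj by (simp add: sum.reindex)
      also have "\<dots> = b + a \<bullet> y"
        by (simp add: sum_option u_def f_def b' a' inner_vec_def)
      finally have *: "u (inv f v) = 0" if "v \<in> range f" for v
        using rat_real.independentD[OF ind, of "range f" "\<lambda>v. u (inv f v)" v] that eq by simp
      have "u i = 0" for i using *[of "f i"] inj by simp
      from this[of None] this[of "Some _"] have "b' = 0" "\<And>j. a' j = 0" by (simp_all add: u_def)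
      then show "b = 0 \<and> a = 0" by (simp add: b' a' vec_eq_iff)
    qed
  next
    assume R: ?R
    have key: "w i = 0" if w: "(\<Sum>i\<in>UNIV. of_rat (w i) * f i) = 0" for w i
    proof -
      have "of_rat (w None) + (\<chi> j. of_rat (w (Some j))) \<bullet> y = 0"
        using w by (simp add: sum_option f_def inner_vec_def)
      then have "of_rat (w None) = (0::real) \<and> (\<chi> j. of_rat (w (Some j))) = (0::real^'n)"
        using R[rule_format, of "of_rat (w None)" "\<chi> j. of_rat (w (Some j))"] by simp
      then show ?thesis by (cases i) (simp_all add: vec_eq_iff)
    qed
    have inj: "inj f"
    proof (rule injI, rule ccontr)
      fix i j assume e: "f i = f j" "i \<noteq> j"
      \<comment> \<open>The relation \<open>f i - f j = 0\<close>, whose coefficient at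
        \<open>i\<close> is 1.\<close>
      let ?w = "\<lambda>k. (if k = i then 1 else 0) - (if k = j then 1 else (0::rat))"
      have "(\<Sum>k\<in>UNIV. of_rat (?w k) * f k)
          = (\<Sum>k\<in>UNIV. (if k = i then f k else 0) - (if k = j then f k else 0))"
        by (intro sum.cong) (auto simp: of_rat_diff)
      also have "\<dots> = 0" using e by (simp add: sum_subtractf)
      finally have "?w i = 0" by (rule key)
      then show False using e by simp
    qed
    have "u v = 0" if "(\<Sum>v\<in>range f. of_rat (u v) * v) = 0" "v \<in> range f" for u v
    proof -
      have "(\<Sum>i\<in>UNIV. of_rat (u (f i)) * f i) = 0" using that(1) inj by (simp add: sum.reindex)
      then show ?thesis using key[of "\<lambda>i. u (f i)"] that(2) by auto
    qed
    then have "rat_real.independent (range f)" by (subst rat_real.dependent_finite) auto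
    then show "y \<in> A_set" using A inj by simp
  qed
qed

lemma A_set_eq_Inter:
  "(A_set :: (real ^ 'n) set) =
        (\<Inter>(q0, q) \<in> {(q0 :: int, q :: int ^ 'n). q \<noteq> 0}.
           {y. of_int q0 + (\<Sum>i\<in>UNIV. of_int (q $ i) * y $ i) \<noteq> 0})" (is "_ = ?R")
proof (intro equalityI subsetI)
  fix y :: "real ^ 'n" assume y: "y \<in> A_set"
  have "q = 0" if "of_int q0 + (\<Sum>i\<in>UNIV. of_int (q $ i) * y $ i) = 0" for q0 and q :: "int ^ 'n"
    using y[unfolded mem_A_set_iff_rational, rule_format, of "of_int q0" "\<chi> i. of_int (q $ i)"] that
    by (simp add: inner_vec_def vec_eq_iff)
  then show "y \<in> ?R" by auto
next
  fix y :: "real ^ 'n" assume y: "y \<in> ?R"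
  show "y \<in> A_set" unfolding mem_A_set_iff_rational
  proof (intro allI impI)
    fix a :: "real ^ 'n" and b :: real
    assume b: "b \<in> \<rat>" and a: "\<forall>i. a $ i \<in> \<rat>" and eq: "b + a \<bullet> y = 0"
    \<comment> \<open>Packing \<open>b\<close> and the entries of \<open>a\<close> into one family
      yields a single common denominator.\<close>
    have "\<exists>N>0. \<forall>i\<in>UNIV. real N * case_option b (($) a) i \<in> \<int>"
      using a b by (intro clear_denominators) (auto split: option.split)
    then obtain N where N: "N > 0" "\<And>i. real N * case_option b (($) a) i \<in> \<int>" by auto
    from N(2)[of None] obtain q0 where q0: "real N * b = of_int q0" by (auto elim: Ints_cases)
    have "\<exists>k. real N * a $ i = of_int k" for i using N(2)[of "Some i"] by (auto elim: Ints_cases)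
    then obtain q where q: "\<And>i. real N * a $ i = of_int (q i)" by metis
    have "of_int q0 + (\<Sum>i\<in>UNIV. of_int ((\<chi> i. q i) $ i) * y $ i) = real N * (b + a \<bullet> y)"
      by (simp add: q0[symmetric] q[symmetric] inner_vec_def sum_distrib_left algebra_simps)
    then have "of_int q0 + (\<Sum>i\<in>UNIV. of_int ((\<chi> i. q i) $ i) * y $ i) = 0" using eq by simp
    then have "(\<chi> i. q i) = 0" using y by blast
    then have "a = 0" using q N(1) by (auto simp: vec_eq_iff)
    then show "b = 0 \<and> a = 0" using eq by simp
  qed
qed

text \<open>The complement is a countable union of hyperplanes, each a genuine one because
  \<open>q \<noteq> 0\<close>.\<close>

lemma negligible_compl_A_set: "negligible (- (A_set :: (real ^ 'n) set))"
proof -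
  have "- (A_set :: (real ^ 'n) set) = (\<Union>(q0, q) \<in> {(q0 :: int, q :: int ^ 'n). q \<noteq> 0}.
           {y. (\<chi> i. of_int (q $ i)) \<bullet> y = - of_int q0})"
    by (auto simp: A_set_eq_Inter inner_vec_def algebra_simps add_eq_0_iff)
  also have "negligible \<dots>"
  proof (rule negligible_countable_Union)
    show "countable ((\<lambda>(q0, q). {y :: real ^ 'n. (\<chi> i. of_int (q $ i)) \<bullet> y = - of_int q0}) `
      {(q0 :: int, q :: int ^ 'n). q \<noteq> 0})" by simp
    show "negligible S" if "S \<in> (\<lambda>(q0, q). {y :: real ^ 'n. (\<chi> i. of_int (q $ i)) \<bullet> y = - of_int q0}) `
      {(q0 :: int, q :: int ^ 'n). q \<noteq> 0}" for S
      using that by (auto intro!: negligible_hyperplane simp: vec_eq_iff)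
  qed
  finally show ?thesis .
qed

text \<open>A negligible set contains no nonempty open set, so the complement has empty
  interior.\<close>

lemma closure_A_set: "closure (A_set :: (real ^ 'n) set) = UNIV"
proof -
  have "interior (- (A_set :: (real ^ 'n) set)) = {}"
    using negligible_compl_A_set negligible_subset interior_subset open_interior open_not_negligible
    by metis
  then show ?thesis by (auto simp: interior_closure)
qed

lemma gdelta_A_set: "gdelta (A_set :: (real ^ 'n) set)"
proof -
  \<comment> \<open>The intersection must run over a sequence, so all pairs are enumerated; those
    with \<open>q = 0\<close> contribute \<open>UNIV\<close>, which leaves the intersection
    unchanged.\<close>
  let ?F = "\<lambda>p. if snd p = 0 then UNIV else
    {y :: real ^ 'n. of_int (fst p) + (\<Sum>i\<in>UNIV. of_int (snd p $ i) * y $ i) \<noteq> 0}"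
  let ?e = "from_nat :: nat \<Rightarrow> int \<times> (int ^ 'n)"
  have "open (?F p)" for p by (auto intro!: open_Collect_neq continuous_intros)
  then have "gdelta (\<Inter>((\<lambda>n. ?F (?e n)) ` UNIV))" by (rule gdelta.intros)
  also have "(\<Inter>((\<lambda>n. ?F (?e n)) ` UNIV)) = (\<Inter>p. ?F p)"
    by (subst image_image[of ?F ?e, symmetric]) (simp only: surj_from_nat)
  also have "\<dots> = A_set" unfolding A_set_eq_Inter set_eq_iff INT_iff
    by (simp add: split_paired_all)
  finally show ?thesis .
qed

subsection \<open>Vectors outside \<open>A_set\<close>\<close>

lemma finite_vec_coords_in:
  assumes "finite A"
  shows "finite {x :: 'a ^ 'n. \<forall>i. x $ i \<in> A}"
proof (rule finite_subset)
  show "{x :: 'a ^ 'n. \<forall>i. x $ i \<in> A} \<subseteq> vec_lambda ` (PiE UNIV (\<lambda>_. A))"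
    by (auto intro!: image_eqI[of _ vec_lambda "\<lambda>i. _ $ i"])
  show "finite (vec_lambda ` (PiE (UNIV :: 'n set) (\<lambda>_. A)))"
    using assms by (intro finite_imageI finite_PiE) auto
qed

lemma unit_cube_rational_polytope: "cbox 0 1 \<in> (rational_polytopes :: (real ^ 'n) set set)"
proof -
  let ?V = "{x :: real ^ 'n. \<forall>i. x $ i = 0 \<or> x $ i = 1}"
  have "finite ?V" using finite_vec_coords_in[of "{0, 1 :: real}"] by simp
  moreover have "\<forall>v\<in>?V. \<forall>i. v $ i \<in> \<rat>"
  proof clarify
    fix v :: "real ^ 'n" and i assume "\<forall>i. v $ i = 0 \<or> v $ i = 1"
    then have "v $ i = 0 \<or> v $ i = 1" ..
    then show "v $ i \<in> \<rat>" by auto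
  qed
  moreover have "cbox 0 1 = convex hull ?V"
    unfolding Cart_1 unit_interval_convex_hull
    by (rule arg_cong[where f="\<lambda>x. convex hull x"]) (simp add: Basis_vec_def inner_axis)
  moreover have "interior (cbox 0 (1 :: real ^ 'n)) \<noteq> {}"
    by (simp add: interior_cbox interval_ne_empty_cart)
  ultimately show ?thesis unfolding rational_polytopes_def by blast
qed

lemma rational_polytope_affine_image:
  fixes \<phi> :: "real ^ 'n \<Rightarrow> real ^ 'n"
  assumes P: "P \<in> rational_polytopes" and "linear \<phi>" "inj \<phi>"
    and rat: "\<And>x i. (\<forall>i. x $ i \<in> \<rat>) \<Longrightarrow> \<phi> x $ i \<in> \<rat>" and c: "\<And>i. c $ i \<in> \<rat>"
  shows "(\<lambda>x. c + \<phi> x) ` P \<in> rational_polytopes"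
proof -
  obtain V where V: "finite V" "\<forall>v\<in>V. \<forall>i. v $ i \<in> \<rat>" "P = convex hull V" "interior P \<noteq> {}"
    using P unfolding rational_polytopes_def by blast
  have im: "(\<lambda>x. c + \<phi> x) ` S = (+) c ` \<phi> ` S" for S by (simp add: image_image)
  have "(\<lambda>x. c + \<phi> x) ` P = convex hull ((\<lambda>x. c + \<phi> x) ` V)"
    unfolding im V(3) convex_hull_linear_image[OF \<open>linear \<phi>\<close>] convex_hull_translation ..
  moreover have "interior ((\<lambda>x. c + \<phi> x) ` P) \<noteq> {}"
    unfolding im interior_translation
    using interior_injective_linear_image[OF \<open>linear \<phi>\<close> \<open>inj \<phi>\<close>] V(4) by auto
  moreover have "\<forall>v\<in>(\<lambda>x. c + \<phi> x) ` V. \<forall>i. v $ i \<in> \<rat>"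
    using V(2) rat c by auto
  ultimately show ?thesis unfolding rational_polytopes_def using V(1) by blast
qed

text \<open>A unit cube is pushed far along one coordinate axis on which \<open>a\<close> is
  nonzero. The shift is integral even if \<open>a\<close> is not rational.\<close>

lemma rational_polytope_in_halfspace:
  fixes a :: "real ^ 'n"
  assumes "a \<noteq> 0"
  obtains P where "P \<in> rational_polytopes" "P \<subseteq> {x. a \<bullet> x > c}"
proof -
  obtain B where B: "\<And>x. x \<in> cbox 0 (1 :: real ^ 'n) \<Longrightarrow> norm x \<le> B"
    using bounded_cbox bounded_iff by metis
  obtain i where i: "a $ i \<noteq> 0" using assms by (auto simp: vec_eq_iff)
  obtain m :: nat where m: "real m * \<bar>a $ i\<bar> > c + norm a * B"
    using i by (meson reals_Archimedean3 zero_less_abs_iff)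
  define v :: "real ^ 'n" where "v = (real m * sgn (a $ i)) *\<^sub>R axis i 1"
  have av: "a \<bullet> v = real m * \<bar>a $ i\<bar>"
    by (simp add: v_def inner_axis abs_sgn)
  have "(\<lambda>x. v + id x) ` cbox 0 1 \<in> rational_polytopes"
    by (rule rational_polytope_affine_image[OF unit_cube_rational_polytope linear_id])
      (auto simp: v_def axis_def sgn_if)
  moreover have "a \<bullet> (v + x) > c" if "x \<in> cbox 0 1" for x
  proof -
    have "\<bar>a \<bullet> x\<bar> \<le> norm a * norm x" by (rule Cauchy_Schwarz_ineq2)
    also have "\<dots> \<le> norm a * B" using B[OF that] by (intro mult_left_mono) auto
    finally show ?thesis using m av by (simp add: inner_add_right)
  qed
  ultimately show ?thesis by (intro that[of "(\<lambda>x. v + id x) ` cbox 0 1"]) auto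
qed

text \<open>Such a map permutes the integer lattice and commutes with dilation.\<close>

lemma lattice_count_unimodular_image:
  fixes \<phi> \<psi> :: "real ^ 'n \<Rightarrow> real ^ 'n"
  assumes "linear \<phi>" and inv: "\<And>x. \<psi> (\<phi> x) = x" "\<And>x. \<phi> (\<psi> x) = x"
    and int: "\<And>x i. (\<forall>i. x $ i \<in> \<int>) \<Longrightarrow> \<phi> x $ i \<in> \<int>" "\<And>x i. (\<forall>i. x $ i \<in> \<int>) \<Longrightarrow> \<psi> x $ i \<in> \<int>"
  shows "lattice_count (\<phi> ` K) t = lattice_count K t"
proof -
  let ?Z = "{z :: real ^ 'n. \<forall>i. z $ i \<in> \<int>}"
  have Z: "\<phi> ` ?Z = ?Z"
  proof
    show "?Z \<subseteq> \<phi> ` ?Z"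
    proof
      fix z assume "z \<in> ?Z"
      then have "\<psi> z \<in> ?Z" using int(2) by simp
      then have "\<phi> (\<psi> z) \<in> \<phi> ` ?Z" by (rule imageI)
      then show "z \<in> \<phi> ` ?Z" by (simp only: inv(2))
    qed
  qed (use int(1) in auto)
  have "inj \<phi>" using inv(1) by (rule inj_on_inverseI)
  have "(*\<^sub>R) t ` \<phi> ` K = \<phi> ` (*\<^sub>R) t ` K"
    by (simp add: image_image linear_scale[OF \<open>linear \<phi>\<close>])
  then have "(*\<^sub>R) t ` \<phi> ` K \<inter> ?Z = \<phi> ` ((*\<^sub>R) t ` K \<inter> ?Z)"
    using Z image_Int[OF \<open>inj \<phi>\<close>] by metis
  then show ?thesis
    unfolding lattice_count_def using card_image[OF inj_on_subset[OF \<open>inj \<phi>\<close> subset_UNIV]] by simp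
qed

text \<open>A unimodular map that moves \<open>y\<close> by a rational vector turns \<open>P + y\<close> into \<open>Q + y\<close> with
  \<open>Q\<close> rational and the same lattice point counts.\<close>

lemma U_real_unimodular_image:
  fixes \<phi> \<psi> :: "real ^ 'n \<Rightarrow> real ^ 'n"
  assumes y: "y \<in> U_real" and P: "P \<in> rational_polytopes"
    and lin: "linear \<phi>" and inv: "\<And>x. \<psi> (\<phi> x) = x" "\<And>x. \<phi> (\<psi> x) = x"
    and int: "\<And>x i. (\<forall>i. x $ i \<in> \<int>) \<Longrightarrow> \<phi> x $ i \<in> \<int>" "\<And>x i. (\<forall>i. x $ i \<in> \<int>) \<Longrightarrow> \<psi> x $ i \<in> \<int>"
    and rat: "\<And>x i. (\<forall>i. x $ i \<in> \<rat>) \<Longrightarrow> \<phi> x $ i \<in> \<rat>" and yrat: "\<And>i. (\<phi> y - y) $ i \<in> \<rat>"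
  shows "(\<lambda>x. (\<phi> y - y) + \<phi> x) ` P = P"
proof -
  let ?Q = "(\<lambda>x. (\<phi> y - y) + \<phi> x) ` P"
  have "inj \<phi>" using inv(1) by (rule inj_on_inverseI)
  have "?Q \<in> rational_polytopes"
    by (rule rational_polytope_affine_image) fact+
  moreover have "(\<lambda>x. x + y) ` ?Q = \<phi> ` (\<lambda>x. x + y) ` P"
    by (simp add: image_image linear_add[OF lin] add.commute)
  then have "lattice_count ((\<lambda>x. x + y) ` ?Q) t = lattice_count ((\<lambda>x. x + y) ` P) t" for t
    using lattice_count_unimodular_image[of \<phi> \<psi>] lin inv int by metis
  ultimately show ?thesis using y P unfolding U_real_def by blast
qed

lemma U_real_subset_A_set: "(U_real :: (real ^ 'n) set) \<subseteq> A_set"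
proof (rule subsetI, rule ccontr)
  fix y :: "real ^ 'n" assume y: "y \<in> U_real" "y \<notin> A_set"
  then obtain q0 :: int and q :: "int ^ 'n" where q: "q \<noteq> 0"
    "of_int q0 + (\<Sum>i\<in>UNIV. of_int (q $ i) * y $ i) = 0"
    by (auto simp: A_set_eq_Inter)
  define a :: "real ^ 'n" where "a = (\<chi> i. of_int (q $ i))"
  have ay: "a \<bullet> y = - of_int q0" using q(2) by (simp add: a_def inner_vec_def)
  have aint: "a \<bullet> x \<in> \<int>" if "\<forall>i. x $ i \<in> \<int>" for x
    using that by (auto simp: inner_vec_def a_def intro!: Ints_sum Ints_mult)
  have arat: "a \<bullet> x \<in> \<rat>" if "\<forall>i. x $ i \<in> \<rat>" for x
    using that by (auto simp: inner_vec_def a_def intro!: Rats_sum Rats_mult)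
  obtain i where i: "q $ i \<noteq> 0" using q(1) by (auto simp: vec_eq_iff)
  then have "a \<noteq> 0" by (auto simp: a_def vec_eq_iff)
  \<comment> \<open>With \<open>a \<bullet> (x + y) > 0\<close> throughout \<open>P\<close>, the
    maps below fix no point of \<open>P + y\<close>.\<close>
  then obtain P where P: "P \<in> rational_polytopes" "P \<subseteq> {x. a \<bullet> x > - (a \<bullet> y)}"
    by (rule rational_polytope_in_halfspace)
  have Pne: "P \<noteq> {}" "compact P"
    using P(1) by (auto simp: rational_polytopes_def finite_imp_compact_convex_hull)
  show False
  proof (cases "\<exists>j. j \<noteq> i")
    case True
    then obtain j where j: "j \<noteq> i" by blast
    \<comment> \<open>An integer vector orthogonal to \<open>a\<close>. Orthogonality keeps
      \<open>a \<bullet> x\<close> invariant under the shear, so subtracting the same multiple of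
      \<open>w\<close> inverts it; \<open>y\<close> moves by \<open>- q0\<close> times
      \<open>w\<close>.\<close>
    define w :: "real ^ 'n" where "w = a $ j *\<^sub>R axis i 1 - a $ i *\<^sub>R axis j 1"
    have aw: "a \<bullet> w = 0" by (simp add: w_def inner_diff_right inner_axis)
    have "w $ j \<noteq> 0" using i j by (simp add: w_def axis_def a_def)
    then have wne: "w \<noteq> 0" by auto
    have wint: "w $ k \<in> \<int>" for k by (simp add: w_def axis_def a_def)
    have wrat: "w $ k \<in> \<rat>" for k using wint Ints_subset_Rats by blast
    define \<phi> where "\<phi> x = x + (a \<bullet> x) *\<^sub>R w" for x
    define \<psi> where "\<psi> x = x - (a \<bullet> x) *\<^sub>R w" for x
    have "linear \<phi>" unfolding \<phi>_def by (intro linearI) (simp_all add: inner_add_right algebra_simps)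
    have "(\<lambda>x. (\<phi> y - y) + \<phi> x) ` P = P"
      by (rule U_real_unimodular_image[OF y(1) P(1) \<open>linear \<phi>\<close>, of \<psi>])
        (simp_all add: \<phi>_def \<psi>_def inner_add_right inner_diff_right aw aint wint arat wrat ay)
    moreover have "(\<phi> y - y) + \<phi> x = x + (a \<bullet> y + a \<bullet> x) *\<^sub>R w" for x
      by (simp add: \<phi>_def algebra_simps)
    ultimately have im: "(\<lambda>x. x + (a \<bullet> y + a \<bullet> x) *\<^sub>R w) ` P = P" by simp
    \<comment> \<open>The induced map of \<open>P\<close> to itself strictly increases
      \<open>w \<bullet> x\<close>, which is impossible at a maximiser.\<close>
    obtain x where x: "x \<in> P" "\<And>z. z \<in> P \<Longrightarrow> w \<bullet> z \<le> w \<bullet> x"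
      using continuous_attains_sup[OF Pne(2,1) continuous_on_inner[OF continuous_on_const continuous_on_id]]
      by metis
    have "w \<bullet> (x + (a \<bullet> y + a \<bullet> x) *\<^sub>R w) \<le> w \<bullet> x" using im x by blast
    then have "(a \<bullet> y + a \<bullet> x) * (w \<bullet> w) \<le> 0" by (simp add: inner_add_right)
    moreover have "(a \<bullet> y + a \<bullet> x) * (w \<bullet> w) > 0"
      using P(2) x(1) wne by (intro mult_pos_pos) auto
    ultimately show False by linarith
  next
    case False
    then have UNIV: "UNIV = {i}" by auto
    \<comment> \<open>In dimension one the relation forces \<open>y\<close> to be rational, so
      negation is admissible. It sends \<open>x + y\<close> to its negative, contradicting
      positivity of \<open>a \<bullet> (x + y)\<close> on \<open>P\<close>.\<close>
    have "y $ k \<in> \<rat>" for k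
    proof -
      have "k = i" using UNIV by auto
      have "of_int (q $ i) * y $ i = - of_int q0" using q(2) by (simp add: UNIV)
      then have "y $ k = - of_int q0 / of_int (q $ i)" using i \<open>k = i\<close> by (simp add: field_simps)
      then show ?thesis by simp
    qed
    then have "(\<lambda>x. (- y - y) + - x) ` P = P"
      by (intro U_real_unimodular_image[OF y(1) P(1), of uminus uminus])
        (auto intro!: linearI)
    then obtain x where x: "x \<in> P" "(- y - y) + - x \<in> P" using Pne by blast
    then have "a \<bullet> x > - (a \<bullet> y)" "a \<bullet> ((- y - y) + - x) > - (a \<bullet> y)" using P(2) by blast+
    then show False unfolding inner_add_right inner_diff_right inner_minus_right by linarith
  qed
qed

subsection \<open>Rational facet inequalities\<close>

lemma inner_Rats:
  fixes a x :: "real ^ 'n"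
  assumes "\<forall>i. a $ i \<in> \<rat>" "\<forall>i. x $ i \<in> \<rat>"
  shows "a \<bullet> x \<in> \<rat>"
  using assms by (auto simp: inner_vec_def intro!: Rats_sum)

text \<open>Gram-Schmidt without normalisation involves only field operations, so it stays over the
  rationals. A zero vector may enter \<open>T\<close>; its coefficient is then a division by zero,
  which is 0.\<close>

lemma rational_orthogonal_spanning_set:
  fixes S :: "(real ^ 'n) set"
  assumes "finite S" "\<forall>v\<in>S. \<forall>i. v $ i \<in> \<rat>"
  obtains T where "finite T" "\<forall>v\<in>T. \<forall>i. v $ i \<in> \<rat>" "pairwise orthogonal T" "span T = span S"
proof -
  have "\<exists>T. finite T \<and> (\<forall>v\<in>T. \<forall>i. v $ i \<in> \<rat>) \<and> pairwise orthogonal T \<and> span T = span S"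
    using assms
  proof (induction S rule: finite_induct)
    case empty
    then show ?case by (intro exI[of _ "{}"]) simp
  next
    case (insert a S)
    then obtain T where T: "finite T" "\<forall>v\<in>T. \<forall>i. v $ i \<in> \<rat>" "pairwise orthogonal T"
      "span T = span S" by auto
    define s where "s = (\<Sum>b\<in>T. (b \<bullet> a / (b \<bullet> b)) *\<^sub>R b)"
    have s: "s \<in> span T" unfolding s_def by (intro span_sum span_scale span_base)
    have "(a - s) $ i \<in> \<rat>" for i
      unfolding s_def using T(2) insert.prems
      by (auto intro!: Rats_sum Rats_diff Rats_mult Rats_divide inner_Rats)
    moreover have "pairwise orthogonal (insert (a - s) T)"
      using T(3) Gram_Schmidt_step[OF T(3)] span_base
      by (intro pairwise_orthogonal_insert) (auto simp: s_def orthogonal_commute)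
    moreover have "span (insert (a - s) T) = span (insert a T)"
      using s by (intro eq_span_insert_eq) (simp add: span_neg)
    moreover have "span (insert a T) = span (insert a S)" using T(4) by (simp add: span_insert)
    ultimately show ?case using T(1,2) by (intro exI[of _ "insert (a - s) T"]) auto
  qed
  then show ?thesis using that by blast
qed

lemma rational_normal_vector:
  fixes S :: "(real ^ 'n) set"
  assumes "finite S" "\<forall>v\<in>S. \<forall>i. v $ i \<in> \<rat>" "span S \<noteq> UNIV"
  obtains a where "a \<noteq> 0" "\<forall>i. a $ i \<in> \<rat>" "\<And>x. x \<in> span S \<Longrightarrow> a \<bullet> x = 0"
proof -
  obtain T where T: "finite T" "\<forall>v\<in>T. \<forall>i. v $ i \<in> \<rat>" "pairwise orthogonal T" "span T = span S"
    using rational_orthogonal_spanning_set assms(1,2) by metis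
  have "\<not> (Basis :: (real ^ 'n) set) \<subseteq> span T"
    using assms(3) T(4) by (metis span_Basis span_mono span_span top.extremum_uniqueI)
  \<comment> \<open>Removing from this axis vector its projection to the span leaves a rational
    normal.\<close>
  then obtain k where k: "axis k (1::real) \<notin> span T" by (auto simp: Basis_vec_def)
  define s where "s = (\<Sum>b\<in>T. (b \<bullet> axis k 1 / (b \<bullet> b)) *\<^sub>R b)"
  have "s \<in> span T" unfolding s_def by (intro span_sum span_scale span_base)
  then have "axis k 1 - s \<noteq> 0" using k by auto
  moreover have "\<forall>i. (axis k 1 - s) $ i \<in> \<rat>"
    unfolding s_def using T(2)
    by (auto intro!: Rats_sum Rats_diff Rats_mult Rats_divide inner_Rats simp: axis_def)
  moreover have "(axis k 1 - s) \<bullet> x = 0" if "x \<in> span S" for x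
    using Gram_Schmidt_step[OF T(3), of x "axis k 1"] that T(4)
    by (simp add: s_def orthogonal_def inner_commute)
  ultimately show ?thesis using that by blast
qed

text \<open>Differences of points of \<open>V\<close> span a space of codimension one, whose normals
  form a line; that line contains both \<open>a\<close> and a rational vector. The factor is
  positive so that rescaling preserves the halfspace.\<close>

lemma rational_hyperplane:
  fixes a :: "real ^ 'n"
  assumes V: "finite V" "\<forall>v\<in>V. \<forall>i. v $ i \<in> \<rat>" "aff_dim V = int CARD('n) - 1"
    and a: "a \<noteq> 0" "\<forall>v\<in>V. a \<bullet> v = b"
  obtains c where "c > 0" "\<forall>i. (c *\<^sub>R a) $ i \<in> \<rat>" "c * b \<in> \<rat>"
proof -
  have "V \<noteq> {}" using V(3) by auto
  then obtain v0 where v0: "v0 \<in> V" by blast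
  define S where "S = (\<lambda>v. v - v0) ` V"
  have "int (dim S) = int CARD('n) - 1"
    using aff_dim_eq_dim_subtract[of v0 V] v0 V(3) by (simp add: S_def hull_inc)
  then have dimS: "dim S + 1 = CARD('n)" by linarith
  then have "span S \<noteq> UNIV" by (metis DIM_cart DIM_real dim_UNIV dim_span mult_1_right n_not_Suc_n Suc_eq_plus1)
  moreover have "finite S" "\<forall>v\<in>S. \<forall>i. v $ i \<in> \<rat>" using V v0 by (auto simp: S_def)
  ultimately obtain a' where a': "a' \<noteq> 0" "\<forall>i. a' $ i \<in> \<rat>" "\<And>x. x \<in> span S \<Longrightarrow> a' \<bullet> x = 0"
    using rational_normal_vector by metis
  have aS: "a \<bullet> x = 0" if "x \<in> span S" for x
    using that by (rule span_induct) (auto simp: subspace_hyperplane S_def inner_diff_right a(2) v0)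
  have "a' \<notin> span S" using a'(1) a'(3)[of a'] by auto
  then have "dim (insert a' S) = DIM(real ^ 'n)" using dimS by (simp add: dim_insert)
  then have "a \<in> span (insert a' S)" using dim_eq_full by blast
  \<comment> \<open>This difference lies in the span and is orthogonal to it, hence
    vanishes.\<close>
  then obtain k where k: "a - k *\<^sub>R a' \<in> span S" using span_breakdown_eq by blast
  then have "(a - k *\<^sub>R a') \<bullet> (a - k *\<^sub>R a') = 0"
    using aS a'(3) by (simp only: inner_diff_left inner_scaleR_left)
  then have ak: "a = k *\<^sub>R a'" by simp
  then have "k \<noteq> 0" using a(1) by auto
  have "\<forall>i. ((1 / \<bar>k\<bar>) *\<^sub>R a) $ i \<in> \<rat>" using a'(2) \<open>k \<noteq> 0\<close> by (auto simp: ak abs_if)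
  moreover from this have "(1 / \<bar>k\<bar>) * b \<in> \<rat>"
    using inner_Rats[of "(1 / \<bar>k\<bar>) *\<^sub>R a" v0] v0 V(2) a(2) by simp
  ultimately show ?thesis using \<open>k \<noteq> 0\<close> by (intro that[of "1 / \<bar>k\<bar>"]) auto
qed

text \<open>An irredundant halfspace description is rescaled facet by facet. Irredundancy supplies,
  on each facet, a point strictly inside all the other halfspaces.\<close>

lemma rational_polytope_halfspaces:
  fixes P :: "(real ^ 'n) set"
  assumes "P \<in> rational_polytopes"
  obtains C where "finite C"
    "\<forall>a b. (a, b) \<in> C \<longrightarrow> a \<noteq> 0 \<and> (\<forall>i. a $ i \<in> \<rat>) \<and> b \<in> \<rat>"
    "P = {x. \<forall>(a, b)\<in>C. a \<bullet> x \<le> b}"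
    "\<forall>a b. (a, b) \<in> C \<longrightarrow> (\<exists>x. a \<bullet> x = b \<and> (\<forall>(a', b')\<in>C - {(a, b)}. a' \<bullet> x < b'))"
proof -
  obtain V where V: "finite V" "\<forall>v\<in>V. \<forall>i. v $ i \<in> \<rat>" "P = convex hull V" "interior P \<noteq> {}"
    using assms unfolding rational_polytopes_def by blast
  have aff: "affine hull P = UNIV" using V(4) by (rule affine_hull_nonempty_interior)
  have "polyhedron P" using V(1,3) polytope_def polytope_imp_polyhedron by blast
  then obtain F where F: "finite F" "P = affine hull P \<inter> \<Inter>F"
      "\<forall>h\<in>F. \<exists>a b. a \<noteq> 0 \<and> h = {x. a \<bullet> x \<le> b}"
      "\<And>F'. F' \<subset> F \<Longrightarrow> P \<subset> affine hull P \<inter> \<Inter>F'"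
    unfolding polyhedron_Int_affine_minimal by blast
  obtain A0 B0 where AB0: "\<And>h. h \<in> F \<Longrightarrow> A0 h \<noteq> 0 \<and> h = {x. A0 h \<bullet> x \<le> B0 h}"
    using F(3) by metis
  have "\<exists>c>0. (\<forall>i. (c *\<^sub>R A0 h) $ i \<in> \<rat>) \<and> c * B0 h \<in> \<rat>" if "h \<in> F" for h
  proof -
    let ?H = "P \<inter> {x. A0 h \<bullet> x = B0 h}"
    have facet: "?H facet_of P"
      using facet_of_polyhedron_explicit[OF F(1,2) AB0 F(4)] that by blast
    \<comment> \<open>A facet is the hull of some of the rational generators, so its hyperplane is
      rational up to scaling.\<close>
    obtain V' where V': "V' \<subseteq> V" "?H = convex hull V'"
      using face_of_convex_hull_subset[OF finite_imp_compact[OF V(1)]] facet V(3)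
      unfolding facet_of_def by metis
    have "aff_dim V' = aff_dim ?H" using V'(2) by (simp add: aff_dim_convex_hull)
    also have "\<dots> = int CARD('n) - 1"
      using facet aff aff_dim_affine_hull[of P] by (simp add: facet_of_def)
    finally have dim: "aff_dim V' = int CARD('n) - 1" .
    have "\<forall>v\<in>V'. A0 h \<bullet> v = B0 h" using V'(2) hull_subset[of V' convex] by blast
    then show ?thesis
      using rational_hyperplane[OF finite_subset[OF V'(1) V(1)] _ dim, of "A0 h" "B0 h"]
        V'(1) V(2) AB0[OF that] by (metis subsetD)
  qed
  then obtain c where c: "\<And>h. h \<in> F \<Longrightarrow> c h > 0"
      "\<And>h. h \<in> F \<Longrightarrow> (\<forall>i. (c h *\<^sub>R A0 h) $ i \<in> \<rat>) \<and> c h * B0 h \<in> \<rat>"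
    by metis
  define A where "A h = c h *\<^sub>R A0 h" for h
  define B where "B h = c h * B0 h" for h
  have AB: "A h \<noteq> 0 \<and> h = {x. A h \<bullet> x \<le> B h}" if "h \<in> F" for h
    using AB0[OF that] c(1)[OF that] by (simp add: A_def B_def)
  have int: "interior P = {x \<in> P. \<forall>h\<in>F. A h \<bullet> x < B h}"
    using rel_interior_polyhedron_explicit[OF F(1,2) AB F(4)]
      rel_interior_interior[OF aff] by simp
  obtain p where p: "\<And>h. h \<in> F \<Longrightarrow> A h \<bullet> p < B h" using V(4) int by auto
  show ?thesis
  proof (rule that[of "(\<lambda>h. (A h, B h)) ` F"])
    show "finite ((\<lambda>h. (A h, B h)) ` F)" using F(1) by simp
    show "\<forall>a b. (a, b) \<in> (\<lambda>h. (A h, B h)) ` F \<longrightarrow> a \<noteq> 0 \<and> (\<forall>i. a $ i \<in> \<rat>) \<and> b \<in> \<rat>"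
      using AB c(2) unfolding A_def B_def by fastforce
    have "x \<in> P \<longleftrightarrow> (\<forall>h\<in>F. A h \<bullet> x \<le> B h)" for x
      using F(2) AB aff by auto
    then show "P = {x. \<forall>(a, b)\<in>(\<lambda>h. (A h, B h)) ` F. a \<bullet> x \<le> b}" by auto
    show "\<forall>a b. (a, b) \<in> (\<lambda>h. (A h, B h)) ` F \<longrightarrow>
        (\<exists>x. a \<bullet> x = b \<and> (\<forall>(a', b')\<in>(\<lambda>h. (A h, B h)) ` F - {(a, b)}. a' \<bullet> x < b'))"
    proof (intro allI impI)
      fix a b assume ab: "(a, b) \<in> (\<lambda>h. (A h, B h)) ` F"
      obtain h where h: "h \<in> F" "a = A h" "b = B h" using ab by auto
      have "P \<subset> \<Inter>(F - {h})" using F(4)[of "F - {h}"] h(1) aff by auto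
      \<comment> \<open>\<open>z\<close> violates the constraint \<open>h\<close> alone.\<close>
      then obtain z where z: "z \<notin> P" "\<And>g. g \<in> F \<Longrightarrow> g \<noteq> h \<Longrightarrow> z \<in> g" by blast
      have zh: "A h \<bullet> z > B h"
        using z AB F(2) aff h(1) by (metis (mono_tags, lifting) Int_UNIV_left InterI linorder_not_le mem_Collect_eq)
      have ph: "A h \<bullet> p < B h" using p h(1) .
      \<comment> \<open>The parameter at which the segment from the interior point \<open>p\<close>
        to \<open>z\<close> crosses the hyperplane of \<open>h\<close>. The weight on
        \<open>p\<close> is positive, so the other constraints stay strict.\<close>
      define u where "u = (B h - A h \<bullet> p) / (A h \<bullet> z - A h \<bullet> p)"
      have u: "0 < u" "u < 1" using zh ph by (auto simp: u_def field_simps)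
      have inner: "d \<bullet> ((1 - u) *\<^sub>R p + u *\<^sub>R z) = (1 - u) * (d \<bullet> p) + u * (d \<bullet> z)" for d
        by (simp add: inner_add_right)
      have "A h \<bullet> ((1 - u) *\<^sub>R p + u *\<^sub>R z) = A h \<bullet> p + u * (A h \<bullet> z - A h \<bullet> p)"
        unfolding inner by (simp add: algebra_simps)
      also have "\<dots> = B h" using zh ph by (simp add: u_def)
      finally have "a \<bullet> ((1 - u) *\<^sub>R p + u *\<^sub>R z) = b" using h by simp
      moreover have "A g \<bullet> ((1 - u) *\<^sub>R p + u *\<^sub>R z) < B g" if g: "g \<in> F" "(A g, B g) \<noteq> (a, b)" for g
      proof -
        have "g \<noteq> h" using g h by auto
        then have "A g \<bullet> z \<le> B g" using z(2)[OF g(1)] AB[OF g(1)] by auto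
        then have "u * (A g \<bullet> z) \<le> u * B g" using u by simp
        moreover have "(1 - u) * (A g \<bullet> p) < (1 - u) * B g" using u p[OF g(1)] by simp
        ultimately show ?thesis unfolding inner by (simp add: algebra_simps)
      qed
      ultimately show "\<exists>x. a \<bullet> x = b \<and> (\<forall>(a', b')\<in>(\<lambda>h. (A h, B h)) ` F - {(a, b)}. a' \<bullet> x < b')"
        by blast
    qed
  qed
qed

subsection \<open>Jumps of the lattice point count\<close>

text \<open>Inverting the dilation factor fixes the polytope and lets each lattice point move
  affinely in \<open>s\<close>, so meeting a facet is a linear equation in \<open>s\<close>.\<close>

definition ray_points :: "real ^ 'n \<Rightarrow> (real ^ 'n) set \<Rightarrow> real \<Rightarrow> (real ^ 'n) set" where
  "ray_points y K s = {z. (\<forall>i. z $ i \<in> \<int>) \<and> s *\<^sub>R z - y \<in> K}"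

lemma lattice_count_translate:
  assumes "t > 0"
  shows "lattice_count ((\<lambda>x. x + y) ` K) t = card (ray_points y K (1 / t))"
proof -
  have "z \<in> (*\<^sub>R) t ` (\<lambda>x. x + y) ` K \<longleftrightarrow> (1 / t) *\<^sub>R z - y \<in> K" for z
  proof
    assume "(1 / t) *\<^sub>R z - y \<in> K"
    moreover have "z = t *\<^sub>R (((1 / t) *\<^sub>R z - y) + y)" using assms by simp
    ultimately show "z \<in> (*\<^sub>R) t ` (\<lambda>x. x + y) ` K" by blast
  qed (use assms in auto)
  then show ?thesis unfolding lattice_count_def ray_points_def
    by (intro arg_cong[where f=card]) auto
qed

text \<open>The bound \<open>(B + norm y) / r\<close> on \<open>norm z\<close> is uniform in
  \<open>s\<close>, so near a given time only finitely many lattice points matter.\<close>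

lemma finite_ray_points_atLeast:
  assumes "bounded K" "r > 0"
  shows "finite (\<Union>s\<in>{r..}. ray_points y K s)"
proof -
  obtain B where B: "\<And>x. x \<in> K \<Longrightarrow> norm x \<le> B" using assms(1) bounded_iff by blast
  have "\<bar>z $ i\<bar> \<le> (B + norm y) / r" if "s \<ge> r" "z \<in> ray_points y K s" for s z i
  proof -
    have "r * norm z \<le> norm (s *\<^sub>R z)" using assms(2) that(1) by (simp add: mult_right_mono)
    also have "\<dots> \<le> norm (s *\<^sub>R z - y) + norm y" by (metis diff_add_cancel norm_triangle_ineq)
    also have "\<dots> \<le> B + norm y" using B that(2) by (simp add: ray_points_def)
    finally have "norm z \<le> (B + norm y) / r" using assms(2) by (simp add: field_simps)
    then show ?thesis using component_le_norm_cart order_trans by blast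
  qed
  then have "(\<Union>s\<in>{r..}. ray_points y K s)
      \<subseteq> {z. \<forall>i. z $ i \<in> {k \<in> \<int>. \<bar>k\<bar> \<le> (B + norm y) / r}}"
    by (auto simp: ray_points_def)
  then show ?thesis
    by (rule finite_subset) (intro finite_vec_coords_in finite_abs_int_segment)
qed

lemma finite_ray_points: "bounded K \<Longrightarrow> s > 0 \<Longrightarrow> finite (ray_points y K s)"
  by (rule finite_subset[OF _ finite_ray_points_atLeast[of K s]]) auto

text \<open>No point enters just before or after \<open>s0\<close>: the finitely many candidates
  outside the closed set \<open>K\<close> at time \<open>s0\<close> stay outside nearby.\<close>

lemma eventually_ray_points_subset:
  assumes "compact K" "s0 > 0"
  shows "\<forall>\<^sub>F s in at s0 within T. ray_points y K s \<subseteq> ray_points y K s0"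
proof -
  let ?Z = "(\<Union>s\<in>{s0 / 2..}. ray_points y K s) - ray_points y K s0"
  have fin: "finite ?Z"
    using assms by (intro finite_Diff finite_ray_points_atLeast compact_imp_bounded) auto
  have "\<forall>\<^sub>F s in at s0 within T. z \<notin> ray_points y K s" if z: "z \<in> ?Z" for z
  proof -
    have "s0 *\<^sub>R z - y \<in> - K" using z by (auto simp: ray_points_def)
    moreover have "((\<lambda>s. s *\<^sub>R z - y) \<longlongrightarrow> s0 *\<^sub>R z - y) (at s0 within T)"
      by (intro tendsto_intros)
    ultimately have "\<forall>\<^sub>F s in at s0 within T. s *\<^sub>R z - y \<in> - K"
      using topological_tendstoD assms(1) compact_imp_closed open_Compl by metis
    then show ?thesis by eventually_elim (simp add: ray_points_def)
  qed
  then have "\<forall>\<^sub>F s in at s0 within T. \<forall>z\<in>?Z. z \<notin> ray_points y K s"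
    by (intro eventually_ball_finite[OF fin] ballI)
  moreover have "\<forall>\<^sub>F s in at s0 within T. s > s0 / 2"
    by (rule order_tendstoD[OF tendsto_ident_at]) (use assms in simp)
  ultimately show ?thesis
  proof eventually_elim
    case (elim s)
    then have "ray_points y K s \<subseteq> (\<Union>s\<in>{s0 / 2..}. ray_points y K s)" by (intro UN_upper) simp
    then show ?case using elim(1) by blast
  qed
qed

text \<open>The sign of \<sigma> selects a side of \<open>s0\<close>. Slack constraints stay slack
  by continuity; a tight one changes with slope \<open>a \<bullet> z\<close>, and the sign condition
  keeps it satisfied on that side.\<close>

lemma eventually_ray_points_superset:
  fixes C :: "((real ^ 'n) \<times> real) set"
  assumes K: "K = {x. \<forall>(a, b)\<in>C. a \<bullet> x \<le> b}" "finite C" "bounded K" and "s0 > 0"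
    and contact: "\<And>z a b. z \<in> ray_points y K s0 \<Longrightarrow> (a, b) \<in> C \<Longrightarrow> a \<bullet> (s0 *\<^sub>R z - y) = b
      \<Longrightarrow> \<sigma> * (a \<bullet> z) \<le> 0"
  shows "\<forall>\<^sub>F s in at s0 within {s. \<sigma> * (s - s0) > 0}. ray_points y K s0 \<subseteq> ray_points y K s"
    (is "eventually _ ?F")
proof -
  have "\<forall>\<^sub>F s in ?F. a \<bullet> (s *\<^sub>R z - y) \<le> b" if z: "z \<in> ray_points y K s0" and ab: "(a, b) \<in> C" for z a b
  proof (cases "a \<bullet> (s0 *\<^sub>R z - y) = b")
    case True
    have "a \<bullet> (s *\<^sub>R z - y) \<le> b" if s: "\<sigma> * (s - s0) > 0" for s
    proof -
      have eq: "a \<bullet> (s *\<^sub>R z - y) = b + (s - s0) * (a \<bullet> z)"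
        using True by (simp add: inner_diff_right algebra_simps)
      have "\<sigma> * (a \<bullet> z) \<le> 0" using contact[OF z ab True] .
      then have "(s - s0) * (a \<bullet> z) \<le> 0"
        using s by (smt (verit) zero_less_mult_iff mult_le_0_iff)
      then show ?thesis using eq by simp
    qed
    then show ?thesis by (simp add: eventually_at_filter)
  next
    case False
    have "s0 *\<^sub>R z - y \<in> K" using z by (simp add: ray_points_def)
    then have "a \<bullet> (s0 *\<^sub>R z - y) \<le> b" using ab unfolding K(1) by blast
    then have "a \<bullet> (s0 *\<^sub>R z - y) < b" using False by simp
    moreover have "((\<lambda>s. a \<bullet> (s *\<^sub>R z - y)) \<longlongrightarrow> a \<bullet> (s0 *\<^sub>R z - y)) ?F"
      by (intro tendsto_intros)
    ultimately have "\<forall>\<^sub>F s in ?F. a \<bullet> (s *\<^sub>R z - y) < b" by (rule order_tendstoD(2)[rotated])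
    then show ?thesis by eventually_elim simp
  qed
  then have "\<forall>\<^sub>F s in ?F. \<forall>z\<in>ray_points y K s0. \<forall>(a, b)\<in>C. a \<bullet> (s *\<^sub>R z - y) \<le> b"
    using finite_ray_points[OF K(3) \<open>s0 > 0\<close>] K(2)
    unfolding split_beta by (intro eventually_ball_finite ballI) simp_all
  then show ?thesis
    by eventually_elim (use K(1) in \<open>auto simp: ray_points_def\<close>)
qed

lemma eventually_one_sided_rational:
  assumes "\<forall>\<^sub>F s in at s0 within {s. \<sigma> * (s - s0) > 0}. Q s" "s0 > 0" "\<sigma> \<noteq> (0::real)"
  obtains s where "s \<in> \<rat>" "s > 0" "Q s"
proof -
  obtain d where d: "d > 0" "\<And>s. \<sigma> * (s - s0) > 0 \<Longrightarrow> s \<noteq> s0 \<Longrightarrow> dist s s0 < d \<Longrightarrow> Q s"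
    using assms(1) unfolding eventually_at by auto
  \<comment> \<open>The cap at \<open>s0\<close> keeps times to the left of \<open>s0\<close>
    positive.\<close>
  define e where "e = min d s0"
  have e: "e > 0" "e \<le> d" "e \<le> s0" using d(1) assms(2) by (auto simp: e_def)
  show ?thesis
  proof (cases "\<sigma> > 0")
    case True
    obtain s where "s \<in> \<rat>" "s0 < s" "s < s0 + e" using Rats_dense_in_real[of s0 "s0 + e"] e by auto
    then show ?thesis using that d(2)[of s] True e assms(2) by (simp add: dist_real_def)
  next
    case False
    obtain s where s: "s \<in> \<rat>" "s0 - e < s" "s < s0" using Rats_dense_in_real[of "s0 - e" s0] e by auto
    then have "\<sigma> * (s - s0) > 0" using False assms(3) by (simp add: zero_less_mult_iff)
    then show ?thesis using that d(2)[of s] s e by (simp add: dist_real_def)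
  qed
qed

lemma eventually_nhds_rational_vec:
  fixes v :: "real ^ 'n"
  assumes "eventually Q (nhds v)"
  obtains r where "\<forall>i. r $ i \<in> \<rat>" "Q r"
proof -
  obtain e where e: "e > 0" "\<And>x. x \<in> ball v e \<Longrightarrow> Q x"
    using assms unfolding eventually_nhds_metric by (auto simp: dist_commute)
  obtain l u where lu: "\<forall>i\<in>Basis. l \<bullet> i \<in> \<rat> \<and> u \<bullet> i \<in> \<rat>" "v \<in> box l u" "box l u \<subseteq> ball v e"
    using rational_boxes[OF e(1)] by metis
  have "\<forall>i. l $ i \<in> \<rat> \<and> u $ i \<in> \<rat>"
    using lu(1) by (auto simp: Basis_vec_def inner_axis)
  then have "\<forall>i. ((1 / 2) *\<^sub>R (l + u)) $ i \<in> \<rat>" by (auto intro!: Rats_divide)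
  moreover have "(1 / 2) *\<^sub>R (l + u) \<in> box l u"
    using lu(2) by (auto simp: mem_box inner_add_left intro: less_trans)
  ultimately show ?thesis using that e(2) lu(3) by blast
qed

text \<open>Since \<open>a \<bullet> z\<close> and \<open>a' \<bullet> z'\<close> are rational, eliminating \<open>s\<close> from the two contact
  equations leaves a rational affine relation satisfied by \<open>y\<close>, which has to be trivial.\<close>

lemma simultaneous_contacts_proportional:
  fixes a a' z z' :: "real ^ 'n"
  assumes y: "y \<in> A_set" and a: "a \<noteq> 0" "\<forall>i. a $ i \<in> \<rat>" "b \<in> \<rat>"
    and a': "a' \<noteq> 0" "\<forall>i. a' $ i \<in> \<rat>" "b' \<in> \<rat>"
    and z: "\<forall>i. z $ i \<in> \<int>" "\<forall>i. z' $ i \<in> \<int>"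
    and eq: "a \<bullet> (s *\<^sub>R z - y) = b" "a' \<bullet> (s *\<^sub>R z' - y) = b'"
  obtains k where "k \<noteq> 0" "a' = k *\<^sub>R a" "b' = k * b" "s * (a' \<bullet> z') = k * (b + a \<bullet> y)"
proof -
  have gen: "d = 0 \<and> c = 0" if "d \<in> \<rat>" "\<forall>i. c $ i \<in> \<rat>" "d + c \<bullet> y = 0" for c d
    using y that unfolding mem_A_set_iff_rational by blast
  have zr: "\<forall>i. z $ i \<in> \<rat>" "\<forall>i. z' $ i \<in> \<rat>" using z Ints_subset_Rats by blast+
  define k1 k2 where "k1 = a \<bullet> z" and "k2 = a' \<bullet> z'"
  have k12: "k1 \<in> \<rat>" "k2 \<in> \<rat>" unfolding k1_def k2_def using a a' zr by (auto intro: inner_Rats)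
  have e: "s * k1 = b + a \<bullet> y" "s * k2 = b' + a' \<bullet> y"
    using eq by (auto simp: k1_def k2_def inner_diff_right)
  have "b + a \<bullet> y \<noteq> 0" "b' + a' \<bullet> y \<noteq> 0" using gen a a' by blast+
  then have k0: "k1 \<noteq> 0" "k2 \<noteq> 0" using e by auto
  have "k2 * (b + a \<bullet> y) = k1 * (b' + a' \<bullet> y)" by (simp flip: e)
  then have "(k2 * b - k1 * b') + (k2 *\<^sub>R a - k1 *\<^sub>R a') \<bullet> y = 0"
    by (simp add: inner_diff_left algebra_simps)
  then have *: "k2 * b - k1 * b' = 0 \<and> k2 *\<^sub>R a - k1 *\<^sub>R a' = 0"
    by (intro gen) (use k12 a a' in auto)
  have "a' = (1 / k1) *\<^sub>R (k1 *\<^sub>R a')" using k0 by simp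
  also have "k1 *\<^sub>R a' = k2 *\<^sub>R a" using * by simp
  finally have "a' = (k2 / k1) *\<^sub>R a" by simp
  moreover have "b' = (k2 / k1) * b" using * k0 by (simp add: field_simps)
  moreover have "s * (a' \<bullet> z') = (k2 / k1) * (b + a \<bullet> y)"
    using k0 by (simp add: k2_def[symmetric] e(1)[symmetric])
  ultimately show ?thesis using k0 by (intro that[of "k2 / k1"]) auto
qed

text \<open>The ray through \<open>x0 + y\<close> hits the facet at \<open>x0\<close>. A nearby
  rational direction still hits the hyperplane at positive time with the other constraints strict,
  and clearing denominators makes it integral.\<close>

lemma lattice_ray_hits_facet:
  fixes C :: "((real ^ 'n) \<times> real) set"
  assumes C: "finite C" and x0: "a \<bullet> x0 = b" "\<forall>(a', b')\<in>C - {(a, b)}. a' \<bullet> x0 < b'"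
    and \<beta>: "b + a \<bullet> y \<noteq> 0"
  obtains z s where "\<forall>i. z $ i \<in> \<int>" "s > 0" "a \<bullet> (s *\<^sub>R z - y) = b"
    "\<forall>(a', b')\<in>C - {(a, b)}. a' \<bullet> (s *\<^sub>R z - y) < b'"
proof -
  define \<beta> where "\<beta> = b + a \<bullet> y"
  define v where "v = x0 + y"
  have av: "a \<bullet> v = \<beta>" "\<beta> \<noteq> 0" using x0(1) \<beta> by (auto simp: v_def \<beta>_def inner_add_right)
  \<comment> \<open>The ray in direction \<open>r\<close> meets the hyperplane at time
    \<open>\<beta> / (a \<bullet> r)\<close>, which is 1 for \<open>r = v\<close>.\<close>
  have lim1: "((\<lambda>r. \<beta> / (a \<bullet> r)) \<longlongrightarrow> \<beta> / (a \<bullet> v)) (nhds v)"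
    using av by (intro tendsto_intros filterlim_ident) auto
  have ev1: "\<forall>\<^sub>F r in nhds v. \<beta> / (a \<bullet> r) > 0"
    by (rule order_tendstoD(1)[OF lim1]) (use av in simp)
  have "\<forall>\<^sub>F r in nhds v. a' \<bullet> ((\<beta> / (a \<bullet> r)) *\<^sub>R r - y) < b'" if "(a', b') \<in> C - {(a, b)}" for a' b'
  proof -
    have "((\<lambda>r. a' \<bullet> ((\<beta> / (a \<bullet> r)) *\<^sub>R r - y)) \<longlongrightarrow> a' \<bullet> ((\<beta> / (a \<bullet> v)) *\<^sub>R v - y)) (nhds v)"
      using av by (intro tendsto_intros filterlim_ident) auto
    moreover have "a' \<bullet> ((\<beta> / (a \<bullet> v)) *\<^sub>R v - y) < b'"
      using x0(2) that av by (auto simp: v_def)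
    ultimately show ?thesis by (rule order_tendstoD(2))
  qed
  then have "\<forall>\<^sub>F r in nhds v. \<forall>(a', b')\<in>C - {(a, b)}. a' \<bullet> ((\<beta> / (a \<bullet> r)) *\<^sub>R r - y) < b'"
    using C by (intro eventually_ball_finite) auto
  with ev1 have "\<forall>\<^sub>F r in nhds v. \<beta> / (a \<bullet> r) > 0 \<and>
      (\<forall>(a', b')\<in>C - {(a, b)}. a' \<bullet> ((\<beta> / (a \<bullet> r)) *\<^sub>R r - y) < b')"
    by (rule eventually_conj)
  then obtain r where r: "\<forall>i. r $ i \<in> \<rat>" "\<beta> / (a \<bullet> r) > 0"
      "\<forall>(a', b')\<in>C - {(a, b)}. a' \<bullet> ((\<beta> / (a \<bullet> r)) *\<^sub>R r - y) < b'"
    by (rule eventually_nhds_rational_vec) auto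
  obtain N where N: "N > 0" "\<forall>i\<in>UNIV. real N * r $ i \<in> \<int>"
    using clear_denominators[of UNIV "\<lambda>i. r $ i"] r(1) by auto
  have sz: "(\<beta> / (a \<bullet> r) / real N) *\<^sub>R (real N *\<^sub>R r) = (\<beta> / (a \<bullet> r)) *\<^sub>R r" using N(1) by simp
  have "a \<bullet> r \<noteq> 0" using r(2) by auto
  then have "a \<bullet> ((\<beta> / (a \<bullet> r)) *\<^sub>R r - y) = b" by (simp add: inner_diff_right \<beta>_def)
  moreover have "\<beta> / (a \<bullet> r) / real N > 0" by (rule divide_pos_pos[OF r(2)]) (use N(1) in simp)
  ultimately show ?thesis
    using N r(3) by (intro that[of "real N *\<^sub>R r" "\<beta> / (a \<bullet> r) / real N", unfolded sz]) auto
qed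

text \<open>The counts are compared only at rational times \<open>s1\<close> and \<open>s2\<close>
  on opposite sides of \<open>s0\<close>; passing from \<open>s1\<close> to \<open>s2\<close>,
  \<open>P\<close> loses a point while \<open>Q\<close> loses none on balance.\<close>

lemma subset_of_lattice_count_eq:
  fixes y :: "real ^ 'n"
  assumes y: "y \<in> A_set" and P: "P \<in> rational_polytopes" and Q: "Q \<in> rational_polytopes"
    and eq: "\<And>t. t \<in> \<rat> \<Longrightarrow> t > 0 \<Longrightarrow>
      lattice_count ((\<lambda>x. x + y) ` P) t = lattice_count ((\<lambda>x. x + y) ` Q) t"
  shows "Q \<subseteq> P"
proof (rule ccontr)
  assume "\<not> Q \<subseteq> P"
  then obtain q where q: "q \<in> Q" "q \<notin> P" by blast
  have card_eq: "card (ray_points y P s) = card (ray_points y Q s)" if "s \<in> \<rat>" "s > 0" for s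
    using eq[of "1 / s"] that by (simp add: lattice_count_translate)
  obtain C where C: "finite C"
    "\<forall>a b. (a, b) \<in> C \<longrightarrow> a \<noteq> 0 \<and> (\<forall>i. a $ i \<in> \<rat>) \<and> b \<in> \<rat>"
    "P = {x. \<forall>(a, b)\<in>C. a \<bullet> x \<le> b}"
    "\<forall>a b. (a, b) \<in> C \<longrightarrow> (\<exists>x. a \<bullet> x = b \<and> (\<forall>(a', b')\<in>C - {(a, b)}. a' \<bullet> x < b'))"
    by (rule rational_polytope_halfspaces[OF P])
  obtain D where D: "finite D"
    "\<forall>a b. (a, b) \<in> D \<longrightarrow> a \<noteq> 0 \<and> (\<forall>i. a $ i \<in> \<rat>) \<and> b \<in> \<rat>"
    "Q = {x. \<forall>(a, b)\<in>D. a \<bullet> x \<le> b}"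
    by (rule rational_polytope_halfspaces[OF Q])
  have compact: "compact P" "compact Q"
    using P Q by (auto simp: rational_polytopes_def finite_imp_compact_convex_hull)
  then have bounded: "bounded P" "bounded Q" by (simp_all add: compact_imp_bounded)
  obtain a b where ab: "(a, b) \<in> C" "a \<bullet> q > b" using q(2) C(3) by force
  note abr = C(2)[rule_format, OF ab(1)]
  have \<beta>: "b + a \<bullet> y \<noteq> 0" using y abr unfolding mem_A_set_iff_rational by blast
  obtain x0 where "a \<bullet> x0 = b" "\<forall>(a', b')\<in>C - {(a, b)}. a' \<bullet> x0 < b'" using C(4)[rule_format, OF ab(1)] by blast
  then obtain z s0 where z: "\<forall>i. z $ i \<in> \<int>" "s0 > 0" "a \<bullet> (s0 *\<^sub>R z - y) = b"
    "\<forall>(a', b')\<in>C - {(a, b)}. a' \<bullet> (s0 *\<^sub>R z - y) < b'"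
    using lattice_ray_hits_facet[OF C(1) _ _ \<beta>] by metis
  define \<sigma> where "\<sigma> = b + a \<bullet> y"
  have \<sigma>: "\<sigma> \<noteq> 0" "- \<sigma> \<noteq> 0" using \<beta> by (auto simp: \<sigma>_def)
  have "a' \<bullet> (s0 *\<^sub>R z - y) \<le> b'" if "(a', b') \<in> C" for a' b'
    using z(3) bspec[OF z(4), of "(a', b')"] that by (cases "(a', b') = (a, b)") auto
  then have zP: "z \<in> ray_points y P s0" using z(1) by (auto simp: ray_points_def C(3))
  have contact: "\<exists>k. k \<noteq> 0 \<and> a' = k *\<^sub>R a \<and> b' = k * b \<and> s0 * (a' \<bullet> z') = k * \<sigma>"
    if "z' \<in> ray_points y K s0" "a' \<noteq> 0 \<and> (\<forall>i. a' $ i \<in> \<rat>) \<and> b' \<in> \<rat>" "a' \<bullet> (s0 *\<^sub>R z' - y) = b'"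
    for K z' a' b'
    using simultaneous_contacts_proportional[OF y _ _ _ _ _ _ z(1) _ z(3) that(3)] abr that(1,2)
    unfolding \<sigma>_def ray_points_def by blast
  \<comment> \<open>A proportional constraint of \<open>P\<close> is tight where \<open>z\<close>
    hits the facet, and there only \<open>(a, b)\<close> is tight; so \<open>k = 1\<close>.\<close>
  have contactP: "- \<sigma> * (a' \<bullet> z') \<le> 0"
    if z': "z' \<in> ray_points y P s0" "(a', b') \<in> C" "a' \<bullet> (s0 *\<^sub>R z' - y) = b'" for z' a' b'
  proof -
    obtain k where k: "k \<noteq> 0" "a' = k *\<^sub>R a" "b' = k * b" "s0 * (a' \<bullet> z') = k * \<sigma>"
      using contact[OF z'(1) C(2)[rule_format, OF z'(2)] z'(3)] by blast
    have "a' \<bullet> (s0 *\<^sub>R z - y) = b'" using k(2,3) z(3) by simp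
    then have "(a', b') = (a, b)" using bspec[OF z(4), of "(a', b')"] z'(2) by fastforce
    then have "k = 1" using k(2) abr by (metis Pair_inject scaleR_cancel_right scaleR_one)
    then have "s0 * (\<sigma> * (a' \<bullet> z')) = \<sigma> * \<sigma>" using k(4) by (simp add: mult.left_commute)
    then have "s0 * (\<sigma> * (a' \<bullet> z')) \<ge> 0" by (simp only: zero_le_square)
    then show ?thesis using z(2) by (simp add: zero_le_mult_iff)
  qed
  \<comment> \<open>The point \<open>q\<close> satisfies this constraint of \<open>Q\<close> but
    violates \<open>(a, b)\<close>, so the factor \<open>k\<close> is negative and the sign
    reverses.\<close>
  have contactQ: "\<sigma> * (a' \<bullet> z') \<le> 0"
    if z': "z' \<in> ray_points y Q s0" "(a', b') \<in> D" "a' \<bullet> (s0 *\<^sub>R z' - y) = b'" for z' a' b'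
  proof -
    obtain k where k: "k \<noteq> 0" "a' = k *\<^sub>R a" "b' = k * b" "s0 * (a' \<bullet> z') = k * \<sigma>"
      using contact[OF z'(1) D(2)[rule_format, OF z'(2)] z'(3)] by blast
    have "a' \<bullet> q \<le> b'" using q(1) z'(2) unfolding D(3) by blast
    then have "k * (a \<bullet> q) \<le> k * b" using k by simp
    then have "k < 0" using ab(2) k(1) by (smt (verit) mult_less_cancel_left_pos)
    then have "k * (\<sigma> * \<sigma>) \<le> 0" by (simp add: mult_nonpos_nonneg)
    moreover have "s0 * (\<sigma> * (a' \<bullet> z')) = k * (\<sigma> * \<sigma>)" using k(4) by (simp add: mult.left_commute)
    ultimately show ?thesis using z(2) by (metis mult_le_0_iff not_less_iff_gr_or_eq order_less_le_trans)
  qed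
  let ?F = "\<lambda>\<sigma>. at s0 within {s. \<sigma> * (s - s0) > 0}"
  \<comment> \<open>On this side \<open>P\<close> keeps all its points and \<open>Q\<close> gains
    none.\<close>
  have "\<forall>\<^sub>F s in ?F (- \<sigma>). ray_points y P s0 \<subseteq> ray_points y P s \<and> ray_points y Q s \<subseteq> ray_points y Q s0"
    by (rule eventually_conj[OF eventually_ray_points_superset[OF C(3,1) bounded(1) z(2) contactP]
      eventually_ray_points_subset[OF compact(2) z(2)]])
  then obtain s1 where s1: "s1 \<in> \<rat>" "s1 > 0"
      "ray_points y P s0 \<subseteq> ray_points y P s1 \<and> ray_points y Q s1 \<subseteq> ray_points y Q s0"
    using eventually_one_sided_rational[OF _ z(2) \<sigma>(2)] by blast
  \<comment> \<open>On the other side \<open>z\<close> itself leaves \<open>P\<close>: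
    \<open>a \<bullet> z\<close> has the sign of \<sigma>, so the facet constraint becomes
    violated.\<close>
  have "z \<notin> ray_points y P s" if s: "\<sigma> * (s - s0) > 0" for s
  proof -
    have "s0 * (a \<bullet> z) = \<sigma>" using z(3) by (simp add: \<sigma>_def inner_diff_right)
    then have "s0 * ((s - s0) * (a \<bullet> z)) = \<sigma> * (s - s0)" by (metis mult.assoc mult.commute)
    then have "s0 * ((s - s0) * (a \<bullet> z)) > 0" using s by (simp only:)
    then have "(s - s0) * (a \<bullet> z) > 0" using z(2) by (simp add: zero_less_mult_iff)
    moreover have "a \<bullet> (s *\<^sub>R z - y) = b + (s - s0) * (a \<bullet> z)"
      using z(3) by (simp add: inner_diff_right algebra_simps)
    ultimately show ?thesis using ab(1) unfolding ray_points_def C(3) by force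
  qed
  then have "\<forall>\<^sub>F s in ?F \<sigma>. z \<notin> ray_points y P s" by (simp add: eventually_at_filter)
  moreover have "\<forall>\<^sub>F s in ?F \<sigma>. ray_points y P s \<subseteq> ray_points y P s0"
    by (rule eventually_ray_points_subset[OF compact(1) z(2)])
  moreover have "\<forall>\<^sub>F s in ?F \<sigma>. ray_points y Q s0 \<subseteq> ray_points y Q s"
    by (rule eventually_ray_points_superset[OF D(3,1) bounded(2) z(2) contactQ])
  ultimately have "\<forall>\<^sub>F s in ?F \<sigma>. ray_points y P s \<subset> ray_points y P s0 \<and> ray_points y Q s0 \<subseteq> ray_points y Q s"
    by eventually_elim (use zP in blast)
  then obtain s2 where s2: "s2 \<in> \<rat>" "s2 > 0"
      "ray_points y P s2 \<subset> ray_points y P s0 \<and> ray_points y Q s0 \<subseteq> ray_points y Q s2"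
    using eventually_one_sided_rational[OF _ z(2) \<sigma>(1)] by blast
  have "card (ray_points y P s2) < card (ray_points y P s0)"
    using s2 finite_ray_points[OF bounded(1) z(2)] by (intro psubset_card_mono) auto
  also have "\<dots> \<le> card (ray_points y P s1)"
    using s1 finite_ray_points[OF bounded(1) s1(2)] by (intro card_mono) auto
  also have "\<dots> = card (ray_points y Q s1)" using card_eq s1 by blast
  also have "\<dots> \<le> card (ray_points y Q s0)"
    using s1 finite_ray_points[OF bounded(2) z(2)] by (intro card_mono) auto
  also have "\<dots> \<le> card (ray_points y Q s2)"
    using s2 finite_ray_points[OF bounded(2) s2(2)] by (intro card_mono) auto
  also have "\<dots> = card (ray_points y P s2)" using card_eq s2 by simp
  finally show False by simp
qed

section \<open>Equality of the three sets\<close>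

lemma A_set_subset_U_rational: "(A_set :: (real ^ 'n) set) \<subseteq> U_rational"
proof
  fix y :: "real ^ 'n" assume y: "y \<in> A_set"
  have "P = Q" if PQ: "P \<in> rational_polytopes" "Q \<in> rational_polytopes"
    and eq: "\<forall>t\<in>\<rat>. t > 0 \<longrightarrow> lattice_count ((\<lambda>x. x + y) ` P) t = lattice_count ((\<lambda>x. x + y) ` Q) t"
    for P Q
    by (intro equalityI subset_of_lattice_count_eq[OF y]) (use PQ eq in auto)
  then show "y \<in> U_rational" unfolding U_rational_def by blast
qed

lemma U_rational_subset_U_real: "(U_rational :: (real ^ 'n) set) \<subseteq> U_real"
  unfolding U_rational_def U_real_def by blast

theorem corollary2:
  shows "(U_rational :: (real ^ 'n) set) = U_real
    \<and> (U_real :: (real ^ 'n) set) = A_set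
    \<and> (A_set :: (real ^ 'n) set) =
        (\<Inter>(q0, q) \<in> {(q0 :: int, q :: int ^ 'n). q \<noteq> 0}.
           {y. of_int q0 + (\<Sum>i\<in>UNIV. of_int (q $ i) * y $ i) \<noteq> 0})
    \<and> closure (A_set :: (real ^ 'n) set) = UNIV
    \<and> gdelta (A_set :: (real ^ 'n) set)
    \<and> - (A_set :: (real ^ 'n) set) \<in> null_sets lebesgue"
proof (intro conjI)
  show "(U_rational :: (real ^ 'n) set) = U_real" "(U_real :: (real ^ 'n) set) = A_set"
    using U_rational_subset_U_real U_real_subset_A_set A_set_subset_U_rational by fast+
  show "- (A_set :: (real ^ 'n) set) \<in> null_sets lebesgue"
    using negligible_compl_A_set by (simp add: negligible_iff_null_sets)
qed (fact A_set_eq_Inter closure_A_set gdelta_A_set)+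

end
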